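(* Let $n,m$ be positive integers and $\alpha_1,\dots,\alpha_n$ the simple roots of type $A_n$. There exists a bijection $\psi_n:\mathcal{D}^m_n\to\mathcal{P}^m_n$ such that for every $i\in\{1,\dots,n\}$ and every $D\in\mathcal{D}^m_n$, the facet $D$ contains the negative simple root $-\alpha_i$ if and only if the $i$-th part of the partition $\psi_n(D)$ equals $(n-i+1)m$.
   Context: Let $P$ be a convex polygon with $m(n+1)+2$ vertices labeled $0,1,\dots,m(n+1)+1$ counterclockwise. An $m$-diagonal is a diagonal of $P$ dividing it into two polygons each with a number of vertices congruent to $2$ mod $m$. An $m$-dissection is a set of $n$ pairwise non-crossing $m$-diagonals; $\mathcal{D}^m_n$ is the set of $m$-dissections (the facets of the $m$-generalized cluster complex $\Delta^m(A_n)$). Negative simple roots: for $1\le i\le\frac{n+1}2$, $-\alpha_{2i-1}$ is the diagonal joining vertices $(i-1)m$ and $(n+1-i)m+1$; for $1\le i\le\frac n2$, $-\alpha_{2i}$ is the diagonal joining $im$ and $(n+1-i)m+1$. $D$ contains $-\alpha_i$ if that diagonal is in $D$. $\mathcal{P}^m_n$ is the set of integer partitions $\lambda=(\lambda_1\ge\cdots\ge\lambda_n\ge0)$ with $\lambda_i\le m(n-i+1)$ for all $i$. *)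

theory Defs
  imports Main
begin

text \<open>Vertices of the polygon P are 0,...,N-1 with N = m(n+1)+2. A diagonal is
represented as an ordered pair (a,b) with a < b.\<close>

definition num_vertices :: "nat \<Rightarrow> nat \<Rightarrow> nat" where
  "num_vertices m n = m * (n + 1) + 2"

text \<open>(a,b) is a diagonal (not a side) and both sub-polygons it cuts off have a
number of vertices congruent to 2 mod m: the polygon a,a+1,...,b has b-a+1
vertices, the other one has N-(b-a)+1 vertices.\<close>
definition m_diagonal :: "nat \<Rightarrow> nat \<Rightarrow> nat \<times> nat \<Rightarrow> bool" where
  "m_diagonal m n d =
     (let N = num_vertices m n; a = fst d; b = snd d in
        a < b \<and> b < N \<and> 2 \<le> b - a \<and> \<not> (a = 0 \<and> b = N - 1) \<and>
        (b - a + 1) mod m = 2 mod m \<and> (N - (b - a) + 1) mod m = 2 mod m)"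

definition crosses :: "nat \<times> nat \<Rightarrow> nat \<times> nat \<Rightarrow> bool" where
  "crosses d e =
     (let a = fst d; b = snd d; c = fst e; f = snd e in
        (a < c \<and> c < b \<and> b < f) \<or> (c < a \<and> a < f \<and> f < b))"

text \<open>The set of m-dissections (facets of the generalized cluster complex).\<close>
definition m_dissections :: "nat \<Rightarrow> nat \<Rightarrow> (nat \<times> nat) set set" where
  "m_dissections m n =
     {D. finite D \<and> card D = n \<and> (\<forall>d\<in>D. m_diagonal m n d) \<and>
         (\<forall>d\<in>D. \<forall>e\<in>D. \<not> crosses d e)}"

text \<open>Partitions lambda_1 \<ge> ... \<ge> lambda_n \<ge> 0 with lambda_i \<le> m(n-i+1),
as lists of length n (lambda_i = lam ! (i-1)).\<close>
definition m_partitions :: "nat \<Rightarrow> nat \<Rightarrow> nat list set" where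
  "m_partitions m n =
     {lam. length lam = n \<and> sorted_wrt (\<ge>) lam \<and> (\<forall>j<n. lam ! j \<le> m * (n - j))}"

definition neg_simple_root :: "nat \<Rightarrow> nat \<Rightarrow> nat \<Rightarrow> nat \<times> nat" where
  "neg_simple_root m n i =
     (if odd i then (let k = (i + 1) div 2 in ((k - 1) * m, (n + 1 - k) * m + 1))
      else (let k = i div 2 in (k * m, (n + 1 - k) * m + 1)))"

end

theory Submission
  imports Defs Complex_Main
begin

text \<open>A bijection matching the two families of subsets of \<open>{1..n}\<close> exists as soon as, for every
  \<open>S \<subseteq> {1..n}\<close>, as many dissections contain all \<open>-\<alpha>\<^sub>i\<close> with \<open>i \<in> S\<close> as there are partitions whose
  \<open>i\<close>-th part is maximal for all \<open>i \<in> S\<close> (Moebius inversion). Cutting the polygon along \<open>-\<alpha>\<^sub>i\<close>, or a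
  partition at its \<open>i\<close>-th part, with \<open>i\<close> the largest element of \<open>S\<close>, factors both counts, which
  reduces the claim to \<open>F\<^sub>n = P\<^sub>n\<close> for the total numbers \<open>F\<^sub>n\<close> of dissections and \<open>P\<^sub>n\<close> of partitions.
  Counting pairs of a dissection and one of its diagonals, and symmetrising, gives
  \<open>2 n F\<^sub>n = (m (n + 1) + 2) (\<Sum>j<n. F\<^sub>j F\<^sub>n\<^sub>-\<^sub>1\<^sub>-\<^sub>j)\<close>. The \<open>P\<^sub>n\<close> are Raney numbers, whose
  convolution formula and closed form yield the same recurrence.\<close>

section \<open>Bijections from superset counts\<close>

text \<open>Moebius inversion as an induction from large \<open>S\<close> to small: the superset
  count at \<open>S\<close> is the fibre over \<open>S\<close> plus the fibres over strictly larger
  \<open>T\<close>, and those already agree.\<close>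

lemma card_fibre_eq_if_card_superset_eq:
  fixes f :: "'a \<Rightarrow> 'c set" and g :: "'b \<Rightarrow> 'c set"
  assumes fin: "finite A" "finite B" "finite I"
    and sub: "\<And>a. a \<in> A \<Longrightarrow> f a \<subseteq> I" "\<And>b. b \<in> B \<Longrightarrow> g b \<subseteq> I"
    and eq: "\<And>S. S \<subseteq> I \<Longrightarrow> card {a \<in> A. S \<subseteq> f a} = card {b \<in> B. S \<subseteq> g b}"
    and "S \<subseteq> I"
  shows "card {a \<in> A. f a = S} = card {b \<in> B. g b = S}"
  using \<open>S \<subseteq> I\<close>
proof (induction "card (I - S)" arbitrary: S rule: less_induct)
  case less
  define \<T> where "\<T> = {T. S \<subset> T \<and> T \<subseteq> I}"
  have fT: "finite \<T>" using fin(3) by (auto simp: \<T>_def intro: finite_subset[of _ "Pow I"])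
  have split: "card {x \<in> X. S \<subseteq> h x} = card {x \<in> X. h x = S} + (\<Sum>T\<in>\<T>. card {x \<in> X. h x = T})"
    if "finite X" "\<And>x. x \<in> X \<Longrightarrow> h x \<subseteq> I" for X :: "'x set" and h :: "'x \<Rightarrow> 'c set"
  proof -
    have "{x \<in> X. S \<subseteq> h x} = {x \<in> X. h x = S} \<union> (\<Union>T\<in>\<T>. {x \<in> X. h x = T})"
      using that(2) by (auto simp: \<T>_def)
    moreover have "card ({x \<in> X. h x = S} \<union> (\<Union>T\<in>\<T>. {x \<in> X. h x = T})) =
        card {x \<in> X. h x = S} + card (\<Union>T\<in>\<T>. {x \<in> X. h x = T})"
      using that(1) fT by (intro card_Un_disjoint) (auto simp: \<T>_def)
    moreover have "card (\<Union>T\<in>\<T>. {x \<in> X. h x = T}) = (\<Sum>T\<in>\<T>. card {x \<in> X. h x = T})"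
      using that(1) fT by (intro card_UN_disjoint) auto
    ultimately show ?thesis by simp
  qed
  have "(\<Sum>T\<in>\<T>. card {a \<in> A. f a = T}) = (\<Sum>T\<in>\<T>. card {b \<in> B. g b = T})"
  proof (rule sum.cong)
    fix T assume "T \<in> \<T>"
    then have "I - T \<subset> I - S" "T \<subseteq> I" by (auto simp: \<T>_def)
    then show "card {a \<in> A. f a = T} = card {b \<in> B. g b = T}"
      using less.hyps[of T] fin(3) by (simp add: psubset_card_mono)
  qed simp
  then show ?case
    using eq[OF less.prems] split[OF fin(1) sub(1)] split[OF fin(2) sub(2)] by simp
qed

lemma ex_bij_betw_if_card_superset_eq:
  fixes f :: "'a \<Rightarrow> 'c set" and g :: "'b \<Rightarrow> 'c set"
  assumes fin: "finite A" "finite B" "finite I"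
    and sub: "\<And>a. a \<in> A \<Longrightarrow> f a \<subseteq> I" "\<And>b. b \<in> B \<Longrightarrow> g b \<subseteq> I"
    and eq: "\<And>S. S \<subseteq> I \<Longrightarrow> card {a \<in> A. S \<subseteq> f a} = card {b \<in> B. S \<subseteq> g b}"
  shows "\<exists>\<psi>. bij_betw \<psi> A B \<and> (\<forall>a\<in>A. g (\<psi> a) = f a)"
proof -
  have "\<exists>h. bij_betw h {a \<in> A. f a = S} {b \<in> B. g b = S}" if "S \<subseteq> I" for S
    using card_fibre_eq_if_card_superset_eq[OF assms that] fin
    by (intro finite_same_card_bij) auto
  then obtain h where h: "\<And>S. S \<subseteq> I \<Longrightarrow> bij_betw (h S) {a \<in> A. f a = S} {b \<in> B. g b = S}"
    by metis
  \<comment> \<open>The fibres over different \<open>S\<close> are disjoint and cover both sets, so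
    the bijections between fibres can be united.\<close>
  define \<psi> where "\<psi> a = h (f a) a" for a
  have im: "\<psi> a \<in> B \<and> g (\<psi> a) = f a" if "a \<in> A" for a
    using bij_betwE[OF h[OF sub(1)[OF that]]] that by (auto simp: \<psi>_def)
  have "inj_on \<psi> A"
  proof (rule inj_onI)
    fix a a' assume a: "a \<in> A" "a' \<in> A" "\<psi> a = \<psi> a'"
    then have "f a = f a'" using im by metis
    then show "a = a'"
      using a inj_onD[OF bij_betw_imp_inj_on[OF h[OF sub(1)[OF a(1)]]], of a a']
      by (simp add: \<psi>_def)
  qed
  moreover have "b \<in> \<psi> ` A" if "b \<in> B" for b
  proof -
    have "b \<in> h (g b) ` {a \<in> A. f a = g b}"
      using bij_betw_imp_surj_on[OF h[OF sub(2)[OF that]]] that by auto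
    then obtain a where "a \<in> A" "f a = g b" "b = h (g b) a" by blast
    then show ?thesis by (intro image_eqI[of _ _ a]) (simp_all add: \<psi>_def)
  qed
  ultimately show ?thesis
    using im by (auto simp: bij_betw_def)
qed

section \<open>Raney numbers\<close>

text \<open>If \<open>C = 1 + x C\<^sup>m\<^sup>+\<^sup>1\<close>, then \<open>raney m n t\<close> is the coefficient of \<open>x\<^sup>n\<close> in \<open>C\<^sup>t\<close>; the
  recursion expands one factor of \<open>C\<^sup>t\<^sup>+\<^sup>1\<close>.\<close>

fun raney :: "nat \<Rightarrow> nat \<Rightarrow> nat \<Rightarrow> nat" where
  "raney m 0 t = 1"
| "raney m (Suc n) 0 = 0"
| "raney m (Suc n) (Suc t) = raney m (Suc n) t + raney m n (t + m + 1)"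

text \<open>Coefficient form of \<open>C^(s+t) = C^s * C^t\<close>. Once the term
  \<open>j = 0\<close> is split off, the recursion applies to every other factor
  \<open>raney m j (Suc s)\<close>.\<close>

lemma raney_convolution: "raney m n (s + t) = (\<Sum>j\<le>n. raney m j s * raney m (n - j) t)"
proof (induction m n s rule: raney.induct)
  case (2 m n)
  have "(\<Sum>j\<le>Suc n. raney m j 0 * raney m (Suc n - j) t) = raney m (Suc n) t"
    by (subst sum.atMost_Suc_shift) simp
  then show ?case by simp
next
  case (3 m n s)
  have "(\<Sum>j\<le>Suc n. raney m j (Suc s) * raney m (Suc n - j) t) =
      raney m (Suc n) t + (\<Sum>j\<le>n. raney m (Suc j) s * raney m (n - j) t)
      + (\<Sum>j\<le>n. raney m j (s + m + 1) * raney m (n - j) t)"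
    by (subst sum.atMost_Suc_shift) (simp add: sum.distrib algebra_simps)
  also have "\<dots> = (\<Sum>j\<le>Suc n. raney m j s * raney m (Suc n - j) t)
      + (\<Sum>j\<le>n. raney m j (s + m + 1) * raney m (n - j) t)"
    by (subst sum.atMost_Suc_shift[of "\<lambda>j. raney m j s * raney m (Suc n - j) t"]) simp
  also have "\<dots> = raney m (Suc n) (Suc s + t)"
    using 3 by (simp add: ac_simps)
  finally show ?case by simp
qed simp

text \<open>Both recursive calls lead to binomials with the same upper index \<open>A\<close>, so
  Pascal's rule can add them. The formula is multiplied out to avoid division.\<close>

lemma raney_closed_form:
  "((m + 1) * n + t) * raney m n t = t * (((m + 1) * n + t) choose n)"
proof (induction m n t rule: raney.induct)
  case (3 m n t)
  define A where "A = (m + 1) * Suc n + t"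
  define X where "X = A choose Suc n"
  define Y where "Y = A choose n"
  have IH1: "A * raney m (Suc n) t = t * X"
    using "3.IH"(1) by (simp add: A_def X_def)
  have "(m + 1) * n + (t + m + 1) = A" by (simp add: A_def algebra_simps)
  then have IH2: "A * raney m n (t + m + 1) = (t + m + 1) * Y"
    using "3.IH"(2) by (simp only: Y_def)
  have nA: "n \<le> A" "A > 0" by (auto simp: A_def algebra_simps)
  have XY: "Suc n * X = (A - n) * Y"
    unfolding X_def Y_def by (simp only: binomial_absorption binomial_absorb_comp)
  then have XY': "(int n + 1) * int X = (int A - int n) * int Y"
    using nA by (metis of_nat_mult of_nat_Suc of_nat_diff add.commute)
  have A': "int A = (int m + 1) * (int n + 1) + int t" by (simp add: A_def algebra_simps)
  have "int A * ((int A + 1) * (int (raney m (Suc n) t) + int (raney m n (t + m + 1)))) =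
      (int A + 1) * (int (A * raney m (Suc n) t) + int (A * raney m n (t + m + 1)))"
    by (simp add: algebra_simps)
  also have "\<dots> = (int A + 1) * (int t * int X + (int t + int m + 1) * int Y)"
    unfolding IH1 IH2 by (simp add: algebra_simps)
  \<comment> \<open>Here \<open>t - A = -(m + 1) * (n + 1)\<close> is used. The two terms besides
    the target cancel by the absorption identity \<open>XY'\<close>.\<close>
  also have "\<dots> = int A * ((int t + 1) * (int X + int Y)) - (int m + 1) * ((int n + 1) * int X)
      + (int A * int m + int t + int m + 1) * int Y"
    unfolding A' by (simp add: algebra_simps)
  also have "\<dots> = int A * ((int t + 1) * (int X + int Y))"
    unfolding XY' A' by (simp add: algebra_simps)
  finally have "(int A + 1) * (int (raney m (Suc n) t) + int (raney m n (t + m + 1))) =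
      (int t + 1) * (int X + int Y)"
    using nA by simp
  then have "int (Suc A * raney m (Suc n) (Suc t)) = int (Suc t * (X + Y))"
    by (simp add: algebra_simps)
  then have "Suc A * raney m (Suc n) (Suc t) = Suc t * (Suc A choose Suc n)"
    by (simp only: of_nat_eq_iff) (simp add: X_def Y_def add.commute)
  moreover have "(m + 1) * Suc n + Suc t = Suc A" by (simp add: A_def)
  ultimately show ?case by metis
qed auto

text \<open>By convolution the sum is \<open>raney m (n - 1) (2 * m + 2)\<close>. The closed form
  turns both sides into binomials \<open>M choose n\<close> and \<open>M choose (n - 1)\<close>,
  whose ratio brings in the number of vertices as \<open>M - (n - 1)\<close>.\<close>

lemma raney_recurrence:
  assumes "0 < n"
  shows "2 * n * raney m n (m + 1) =
    (m * (n + 1) + 2) * (\<Sum>j<n. raney m j (m + 1) * raney m (n - 1 - j) (m + 1))"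
proof -
  obtain p where n: "n = Suc p" using assms gr0_implies_Suc by blast
  define M where "M = (m + 1) * (n + 1)"
  have M: "(m + 1) * n + (m + 1) = M" "(m + 1) * p + (2 * m + 2) = M"
    by (simp_all add: M_def n algebra_simps)
  have 1: "(n + 1) * raney m n (m + 1) = M choose n"
  proof -
    have "(m + 1) * ((n + 1) * raney m n (m + 1)) = (m + 1) * (M choose n)"
      using raney_closed_form[of m n "m + 1"] unfolding M(1) by (simp only: M_def mult.assoc)
    then show ?thesis by (metis mult_left_cancel add_is_0 one_neq_zero)
  qed
  have 2: "(n + 1) * raney m p (2 * m + 2) = 2 * (M choose p)"
  proof -
    have "(m + 1) * ((n + 1) * raney m p (2 * m + 2)) = (m + 1) * (2 * (M choose p))"
      using raney_closed_form[of m p "2 * m + 2"] unfolding M(2)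
      by (simp add: M_def algebra_simps)
    then show ?thesis by (metis mult_left_cancel add_is_0 one_neq_zero)
  qed
  have 3: "n * (M choose n) = (m * (n + 1) + 2) * (M choose p)"
  proof -
    have "M - p = m * (n + 1) + 2" by (simp add: M_def n algebra_simps)
    then show ?thesis unfolding n
      using binomial_absorb_comp[of M p] binomial_absorption[of p M] by simp
  qed
  have "(n + 1) * (2 * n * raney m n (m + 1)) =
      (n + 1) * ((m * (n + 1) + 2) * raney m p (2 * m + 2))"
    using 1 2 3 by (metis mult.assoc mult.left_commute)
  then have "2 * n * raney m n (m + 1) = (m * (n + 1) + 2) * raney m p (2 * m + 2)"
    by (metis mult_left_cancel add_is_0 one_neq_zero)
  also have "2 * m + 2 = (m + 1) + (m + 1)" by simp
  finally show ?thesis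
    unfolding raney_convolution by (simp add: n lessThan_Suc_atMost)
qed

section \<open>Partitions\<close>

text \<open>The slack \<open>t\<close> makes the family closed under the recursion of
  \<open>raney\<close>. The strict bound leaves nothing for \<open>t = 0\<close> and positive
  \<open>n\<close>, as in the second equation of \<open>raney\<close>.\<close>

definition bounded_partitions :: "nat \<Rightarrow> nat \<Rightarrow> nat \<Rightarrow> nat list set" where
  "bounded_partitions m n t =
     {lam. length lam = n \<and> sorted_wrt (\<ge>) lam \<and> (\<forall>j<n. lam ! j < m * (n - 1 - j) + t)}"

lemma bounded_partitions_0: "bounded_partitions m 0 t = {[]}"
  by (force simp: bounded_partitions_def)

lemma bounded_partitions_Suc_0: "bounded_partitions m (Suc n) 0 = {}"
  by (fastforce simp: bounded_partitions_def)

text \<open>The last part is the smallest. If it is positive, 1 can be subtracted from every part;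
  if it is zero it is dropped, and the step of \<open>m\<close> between consecutive bounds moves
  into the slack.\<close>

lemma bounded_partitions_Suc_Suc:
  "bounded_partitions m (Suc n) (Suc t) =
     map Suc ` bounded_partitions m (Suc n) t \<union>
     (\<lambda>\<mu>. \<mu> @ [0]) ` bounded_partitions m n (t + m + 1)" (is "?L = ?A \<union> ?B")
proof
  show "?L \<subseteq> ?A \<union> ?B"
  proof
    fix lam assume lam: "lam \<in> ?L"
    then have len: "length lam = Suc n" by (simp add: bounded_partitions_def)
    then obtain \<mu> z where \<mu>: "lam = \<mu> @ [z]" by (metis length_Suc_conv_rev)
    show "lam \<in> ?A \<union> ?B"
    proof (cases z)
      case 0
      have "\<mu> ! j < m * (n - 1 - j) + (t + m + 1)" if "j < n" for j
      proof -
        obtain d where "n = Suc (j + d)" using less_imp_Suc_add[OF \<open>j < n\<close>] by blast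
        moreover have "lam ! j < m * (n - j) + Suc t"
          using lam that by (auto simp: bounded_partitions_def)
        moreover have "lam ! j = \<mu> ! j" using that len \<mu> by (simp add: nth_append)
        ultimately show ?thesis by simp
      qed
      then have "\<mu> \<in> bounded_partitions m n (t + m + 1)"
        using lam \<mu> by (auto simp: bounded_partitions_def sorted_wrt_append)
      then show ?thesis using 0 \<mu> by blast
    next
      case (Suc y)
      define \<nu> where "\<nu> = map (\<lambda>x. x - 1) lam"
      have pos: "0 < x" if "x \<in> set lam" for x
        using that lam Suc \<mu> by (auto simp: bounded_partitions_def sorted_wrt_append)
      then have eq: "lam = map Suc \<nu>" by (auto simp: \<nu>_def comp_def intro!: map_idI[symmetric])
      then have "\<nu> \<in> bounded_partitions m (Suc n) t"
        using lam by (fastforce simp: bounded_partitions_def sorted_wrt_map)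
      then show ?thesis using eq by blast
    qed
  qed
  have "?A \<subseteq> ?L"
    by (auto simp: bounded_partitions_def sorted_wrt_map)
  moreover have "\<mu> @ [0] \<in> ?L" if \<mu>: "\<mu> \<in> bounded_partitions m n (t + m + 1)" for \<mu>
  proof -
    have "(\<mu> @ [0]) ! j < m * (n - j) + Suc t" if "j < Suc n" for j
    proof (cases "j = n")
      case True
      then show ?thesis using \<mu> by (auto simp: bounded_partitions_def nth_append)
    next
      case False
      then obtain d where d: "n = Suc (j + d)" using \<open>j < Suc n\<close> less_imp_Suc_add[of j n] by fastforce
      then have "j < n" by simp
      then have "\<mu> ! j < m * (n - 1 - j) + (t + m + 1)" "length \<mu> = n"
        using \<mu> by (auto simp: bounded_partitions_def)
      then show ?thesis using d by (simp add: nth_append)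
    qed
    then show ?thesis using \<mu> by (auto simp: bounded_partitions_def sorted_wrt_append)
  qed
  ultimately show "?A \<union> ?B \<subseteq> ?L" by blast
qed

lemma card_bounded_partitions:
  "finite (bounded_partitions m n t) \<and> card (bounded_partitions m n t) = raney m n t"
proof (induction m n t rule: raney.induct)
  case (3 m n t)
  have "map Suc ` bounded_partitions m (Suc n) t \<inter>
      (\<lambda>\<mu>. \<mu> @ [0]) ` bounded_partitions m n (t + m + 1) = {}"
    by (auto simp: map_eq_append_conv)
  moreover have "inj_on (map Suc) X" for X by (simp add: inj_on_def)
  moreover have "inj_on (\<lambda>\<mu>. \<mu> @ [0 :: nat]) X" for X by (simp add: inj_on_def)
  ultimately show ?case
    using 3 by (simp add: bounded_partitions_Suc_Suc card_Un_disjoint card_image)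
qed (simp_all add: bounded_partitions_0 bounded_partitions_Suc_0)

lemma m_partitions_eq: "m_partitions m n = bounded_partitions m n (m + 1)"
proof -
  have "m * (n - 1 - j) + (m + 1) = Suc (m * (n - j))" if "j < n" for j
  proof -
    obtain d where "n = Suc (j + d)" using less_imp_Suc_add[OF \<open>j < n\<close>] by blast
    then show ?thesis by simp
  qed
  then show ?thesis by (auto simp: m_partitions_def bounded_partitions_def)
qed

lemma finite_m_partitions: "finite (m_partitions m n)"
  and card_m_partitions: "card (m_partitions m n) = raney m n (m + 1)"
  using card_bounded_partitions by (auto simp: m_partitions_eq)


section \<open>Cutting dissections along a diagonal\<close>

text \<open>The congruence makes \<open>b - a - 1\<close> a multiple \<open>m * k\<close>. The value
  \<open>k = 0\<close> would give a side, and \<open>k = n + 1\<close> the excluded side from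
  \<open>0\<close> to the last vertex.\<close>

lemma m_diagonal_iff:
  assumes "0 < m"
  shows "m_diagonal m n d \<longleftrightarrow>
    (\<exists>k a. 1 \<le> k \<and> k \<le> n \<and> a + m * k \<le> m * (n + 1) \<and> d = (a, a + m * k + 1))"
    (is "?L \<longleftrightarrow> ?R")
proof
  assume d: ?L
  obtain a b where ab: "d = (a, b)" by force
  from d have d': "a < b" "b \<le> m * (n + 1) + 1" "2 \<le> b - a"
    "\<not> (a = 0 \<and> b = m * (n + 1) + 1)" "(b - a + 1) mod m = 2 mod m"
    by (auto simp: m_diagonal_def num_vertices_def ab Let_def)
  define c where "c = b - a - 1"
  have b: "b = a + c + 1" "1 \<le> c" using d' by (auto simp: c_def)
  have "m dvd (c + 2) - 2"
    using d'(5) b by (subst mod_eq_dvd_iff_nat[symmetric]) (simp_all add: numeral_2_eq_2)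
  then obtain k where k: "c = m * k" by auto
  have "k \<ge> 1" using b k by (cases k) auto
  have "m * k \<le> m * (n + 1)" using d'(2) b k by linarith
  then have "k \<le> n + 1" using assms by (metis mult_le_cancel1)
  moreover have "k \<noteq> n + 1"
  proof
    assume "k = n + 1"
    then have "a = 0" "b = m * (n + 1) + 1" using d'(2) b k by auto
    then show False using d'(4) by blast
  qed
  ultimately show ?R using \<open>k \<ge> 1\<close> d'(2) b k ab by (intro exI[of _ k] exI[of _ a]) auto
next
  assume ?R
  then obtain k a where k: "1 \<le> k" "k \<le> n" "a + m * k \<le> m * (n + 1)" "d = (a, a + m * k + 1)"
    by blast
  obtain l where l: "n = k + l" using k(2) le_Suc_ex by blast
  have "m * (n + 1) + 2 - (m * k + 1) + 1 = m * (l + 1) + 2" by (simp add: l algebra_simps)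
  then have outer: "(m * (n + 1) + 2 - (m * k + 1) + 1) mod m = 2 mod m"
    by (simp only: mod_mult_self4)
  have inner: "(m * k + 1 + 1) mod m = 2 mod m" using mod_mult_self4[of m k 2] by simp
  have "1 \<le> m * k" using assms k(1) by simp
  moreover have "m * k < m * (n + 1)" using assms k(2) by (simp only: mult_less_cancel1) simp
  moreover have "a + m * k + 1 - a = m * k + 1" by simp
  ultimately show ?L
    using k(3) unfolding m_diagonal_def num_vertices_def Let_def k(4) fst_conv snd_conv
    by (intro conjI notI; (elim conjE)?; (simp only: inner outer | linarith))
qed

text \<open>Leaves the cardinality open, so that the two pieces of a cut dissection can be treated
  before their sizes are known.\<close>

definition noncrossing :: "nat \<Rightarrow> nat \<Rightarrow> (nat \<times> nat) set \<Rightarrow> bool" where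
  "noncrossing m n D \<longleftrightarrow>
     finite D \<and> (\<forall>d\<in>D. m_diagonal m n d) \<and> (\<forall>d\<in>D. \<forall>e\<in>D. \<not> crosses d e)"

definition shift :: "nat \<Rightarrow> nat \<times> nat \<Rightarrow> nat \<times> nat" where
  "shift c = map_prod (\<lambda>v. v + c) (\<lambda>v. v + c)"

text \<open>\<open>spread c w\<close> undoes the contraction of the polygon that turns the diagonal
  \<open>(c, c + w + 1)\<close> into the side \<open>(c, c + 1)\<close>.\<close>

definition spread :: "nat \<Rightarrow> nat \<Rightarrow> nat \<times> nat \<Rightarrow> nat \<times> nat" where
  "spread c w = map_prod (\<lambda>v. if v \<le> c then v else v + w) (\<lambda>v. if v \<le> c then v else v + w)"

text \<open>The comparisons are weak, so \<open>e\<close> is under itself and has to be excluded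
  explicitly where only the inner diagonals are meant.\<close>

definition under :: "nat \<times> nat \<Rightarrow> nat \<times> nat \<Rightarrow> bool" where
  "under e d \<longleftrightarrow> fst e \<le> fst d \<and> snd d \<le> snd e"

definition glue :: "nat \<Rightarrow> nat \<Rightarrow> (nat \<times> nat) set \<times> (nat \<times> nat) set \<Rightarrow> (nat \<times> nat) set" where
  "glue c w = (\<lambda>(A, B). insert (c, c + w + 1) (shift c ` A \<union> spread c w ` B))"

section \<open>Crossings under the two embeddings of smaller polygons\<close>

lemma shift_simp [simp]: "shift c (x, y) = (x + c, y + c)"
  by (simp add: shift_def)

lemma spread_simp:
  "spread c w (x, y) = (if x \<le> c then x else x + w, if y \<le> c then y else y + w)"
  by (simp add: spread_def)

lemma inj_shift: "inj (shift c)"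
  by (auto simp: inj_def)

lemma inj_spread: "inj (spread c w)"
  by (auto simp: inj_def spread_simp split: if_splits)

lemma crosses_shift: "crosses (shift c d) (shift c e) \<longleftrightarrow> crosses d e"
  by (cases d; cases e) (auto simp: crosses_def)

lemma crosses_spread: "crosses (spread c w d) (spread c w e) \<longleftrightarrow> crosses d e"
proof -
  define g where "g v = (if v \<le> c then v else v + w)" for v
  have "g x < g y \<longleftrightarrow> x < y" for x y by (auto simp: g_def)
  moreover have "spread c w = map_prod g g" by (simp add: spread_def g_def fun_eq_iff)
  ultimately show ?thesis by (cases d; cases e) (simp add: crosses_def)
qed

text \<open>The labels strictly between \<open>c\<close> and \<open>c + w + 1\<close> are skipped by
  \<open>spread\<close>, while both ends of \<open>d\<close> lie between \<open>c\<close> and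
  \<open>c + w + 1\<close> inclusively.\<close>

lemma not_crosses_under_spread:
  assumes "under (c, c + w + 1) d"
  shows "\<not> crosses d (spread c w e)" "\<not> crosses (spread c w e) d"
  using assms by (cases d; cases e; auto simp: crosses_def spread_simp under_def split: if_splits)+

lemma not_crosses_under:
  assumes "under e d"
  shows "\<not> crosses d e" "\<not> crosses e d"
  using assms by (cases d; cases e; auto simp: crosses_def under_def)+

text \<open>If one end were strictly inside the gap, not crossing the cut would force the other end
  into the closed gap too, putting the diagonal under the cut. So both ends are labels that
  \<open>spread\<close> reaches.\<close>

lemma ex_spread_if_not_crosses:
  assumes "\<not> crosses (x, y) (c, c + w + 1)" "\<not> under (c, c + w + 1) (x, y)" "x < y"
  shows "\<exists>d. (x, y) = spread c w d"
proof -
  have *: "\<exists>u. v = (if u \<le> c then u else u + w)" if "v \<le> c \<or> c + w + 1 \<le> v" for v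
    using that by (intro exI[of _ "if v \<le> c then v else v - w"]) auto
  have xy: "x \<le> c \<or> c + w + 1 \<le> x" "y \<le> c \<or> c + w + 1 \<le> y"
    using assms by (auto simp: crosses_def under_def)
  obtain u where "x = (if u \<le> c then u else u + w)" using *[OF xy(1)] ..
  moreover obtain v where "y = (if v \<le> c then v else v + w)" using *[OF xy(2)] ..
  ultimately show ?thesis by (intro exI[of _ "(u, v)"]) (simp add: spread_simp)
qed

text \<open>The cut leaves two polygons of the same kind: the one under \<open>e\<close> has
  \<open>m * k + 2\<close> vertices, hence parameter \<open>k - 1\<close>, and the other, with
  \<open>e\<close> contracted to a side, has parameter \<open>n - k\<close>.\<close>

locale cut =
  fixes m n k c :: nat
  assumes m: "0 < m" and k: "1 \<le> k" "k \<le> n" and c: "c + m * k \<le> m * (n + 1)"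
begin

abbreviation e where "e \<equiv> (c, c + m * k + 1)"

lemma m_diagonal_e: "m_diagonal m n e"
  using m k c by (auto simp: m_diagonal_iff)

text \<open>In the polygon under \<open>e\<close>, the diagonal \<open>e\<close> itself becomes the
  side from the first to the last vertex, which is no diagonal there.\<close>

lemma m_diagonal_shift_iff:
  "m_diagonal m (k - 1) d \<longleftrightarrow> m_diagonal m n (shift c d) \<and> under e (shift c d) \<and> shift c d \<noteq> e"
proof
  assume "m_diagonal m (k - 1) d"
  then obtain j a where j: "1 \<le> j" "j \<le> k - 1" "a + m * j \<le> m * k" "d = (a, a + m * j + 1)"
    using m k by (auto simp: m_diagonal_iff)
  moreover have "j < k" using j k by simp
  moreover have "a + c + m * j \<le> m * (n + 1)" using j c by linarith
  ultimately show "m_diagonal m n (shift c d) \<and> under e (shift c d) \<and> shift c d \<noteq> e"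
    using m k by (auto simp: m_diagonal_iff under_def)
next
  assume d: "m_diagonal m n (shift c d) \<and> under e (shift c d) \<and> shift c d \<noteq> e"
  then obtain j a where j: "1 \<le> j" "shift c d = (a, a + m * j + 1)"
    using m by (auto simp: m_diagonal_iff)
  define b where "b = a - c"
  have b: "a = c + b" "d = (b, b + m * j + 1)" using j d by (cases d; auto simp: b_def)+
  then have le: "b + m * j \<le> m * k" using d by (auto simp: under_def)
  then have "m * j \<le> m * k" by linarith
  then have "j \<le> k" using m by (metis mult_le_cancel1 not_gr_zero)
  moreover have "j \<noteq> k" using d b le by auto
  ultimately show "m_diagonal m (k - 1) d"
    using m k j b le by (subst m_diagonal_iff) (auto intro!: exI[of _ j])
qed

lemma m_diagonal_spread:
  assumes "m_diagonal m (n - k) d"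
  shows "m_diagonal m n (spread c (m * k) d)" "\<not> under e (spread c (m * k) d)"
proof -
  obtain l where l: "n = k + l" using k le_Suc_ex by blast
  obtain j a where j: "1 \<le> j" "j \<le> l" "a + m * j \<le> m * (l + 1)" "d = (a, a + m * j + 1)"
    using assms m l by (auto simp: m_diagonal_iff)
  have n: "m * (n + 1) = m * k + m * (l + 1)" by (simp add: l algebra_simps)
  have pos: "0 < m * j" using m j by simp
  \<comment> \<open>The diagonal lies before, around or after the contracted side. Only in the
    middle case do its ends move apart, turning \<open>j\<close> into \<open>j + k\<close>.\<close>
  consider "a + m * j + 1 \<le> c" | "a \<le> c" "c < a + m * j + 1" | "c < a" by linarith
  then show "m_diagonal m n (spread c (m * k) d)"
  proof cases
    case 1
    then show ?thesis
      using m j l n by (subst m_diagonal_iff) (auto simp: spread_simp intro!: exI[of _ j])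
  next
    case 2
    then show ?thesis
      using m j l n by (subst m_diagonal_iff)
        (auto simp: spread_simp algebra_simps intro!: exI[of _ "j + k"])
  next
    case 3
    then show ?thesis
      using m j l n by (subst m_diagonal_iff) (auto simp: spread_simp intro!: exI[of _ j])
  qed
  show "\<not> under e (spread c (m * k) d)"
    using pos j by (auto simp: spread_simp under_def split: if_splits)
qed

lemma m_diagonal_if_spread:
  assumes "m_diagonal m n (spread c (m * k) d)" "spread c (m * k) d \<noteq> e"
  shows "m_diagonal m (n - k) d"
proof -
  obtain l where l: "n = k + l" using k le_Suc_ex by blast
  obtain x y where d: "d = (x, y)" by force
  obtain j a where j: "1 \<le> j" "j \<le> n" "a + m * j \<le> m * (n + 1)"
    "spread c (m * k) d = (a, a + m * j + 1)"
    using assms m by (auto simp: m_diagonal_iff)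
  have n: "m * (n + 1) = m * k + m * (l + 1)" by (simp add: l algebra_simps)
  have pos: "0 < m * j" using m j by simp
  have le: "j \<le> l" if "m * j < m * (l + 1)" for j
    using that by (simp add: less_Suc_eq_le flip: Suc_eq_plus1 del: mult_Suc_right)
  consider "y \<le> c" | "x \<le> c" "c < y" | "c < x" "c < y" | "c < x" "y \<le> c" by linarith
  then show ?thesis
  proof cases
    case 1
    then have "y = x + m * j + 1" using j d by (auto simp: spread_simp split: if_splits)
    moreover have "j \<le> l" using 1 c n calculation by (intro le) linarith
    ultimately show ?thesis
      using m j l n c d 1 by (subst m_diagonal_iff) (auto intro!: exI[of _ j])
  next
    case 2
    then have y: "y + m * k = x + m * j + 1" using j d by (simp add: spread_simp)
    with 2 have "m * k \<le> m * j" by linarith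
    then have "k \<le> j" using m by (metis mult_le_cancel1 not_gr_zero)
    then obtain i where i: "j = k + i" using le_Suc_ex by blast
    have y': "y = x + m * i + 1" using y by (simp add: i algebra_simps)
    \<comment> \<open>With \<open>i = 0\<close> the pair would be the contracted side
      \<open>(c, c + 1)\<close>, which spreads to \<open>e\<close>.\<close>
    have "i \<noteq> 0"
    proof
      assume "i = 0"
      then have "x = c" "y = c + 1" using y' 2 by auto
      then show False using assms(2) d by (simp add: spread_simp)
    qed
    moreover have "x + m * i \<le> m * (l + 1)"
      using j(3,4) 2 d n by (simp add: spread_simp i algebra_simps)
    ultimately show ?thesis
      using m j l i d y' by (subst m_diagonal_iff) (auto intro!: exI[of _ i])
  next
    case 3
    then have x: "a = x + m * k" "y = x + m * j + 1" using j d by (auto simp: spread_simp)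
    then have "x + m * j \<le> m * (l + 1)" using j(3) n by linarith
    moreover have "j \<le> l" using 3 calculation by (intro le) linarith
    ultimately show ?thesis
      using m j l d x by (subst m_diagonal_iff) (auto intro!: exI[of _ j])
  next
    case 4
    then show ?thesis using j d pos by (auto simp: spread_simp)
  qed
qed

text \<open>Diagonals from different pieces are separated by \<open>e\<close>; two from the same
  piece cross only if their originals in \<open>A\<close> or in \<open>B\<close> do.\<close>

lemma glue_mem_noncrossing:
  assumes A: "noncrossing m (k - 1) A" and B: "noncrossing m (n - k) B"
  shows "noncrossing m n (glue c (m * k) (A, B))"
proof -
  have u: "under e d" if "d \<in> insert e (shift c ` A)" for d
    using that A m_diagonal_shift_iff by (auto simp: noncrossing_def under_def)
  have dA: "m_diagonal m n d" if "d \<in> shift c ` A" for d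
    using that A m_diagonal_shift_iff by (auto simp: noncrossing_def)
  have dB: "m_diagonal m n d" if "d \<in> spread c (m * k) ` B" for d
    using that B m_diagonal_spread by (auto simp: noncrossing_def)
  have "\<not> crosses d d'" if dd: "d \<in> glue c (m * k) (A, B)" "d' \<in> glue c (m * k) (A, B)" for d d'
  proof -
    consider "d = e" "under e d'" | "d' = e" "under e d"
      | "d \<in> shift c ` A" "d' \<in> shift c ` A"
      | "under e d" "d' \<in> spread c (m * k) ` B" | "under e d'" "d \<in> spread c (m * k) ` B"
      | "d \<in> spread c (m * k) ` B" "d' \<in> spread c (m * k) ` B"
      using dd u unfolding glue_def by blast
    then show ?thesis
    proof cases
      case 3
      then show ?thesis using A by (auto simp: noncrossing_def crosses_shift simp del: shift_simp)
    next
      case 6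
      then show ?thesis using B by (auto simp: noncrossing_def crosses_spread)
    qed (use not_crosses_under not_crosses_under_spread in blast)+
  qed
  moreover have "m_diagonal m n d" if "d \<in> glue c (m * k) (A, B)" for d
    using that m_diagonal_e dA dB unfolding glue_def by blast
  moreover have "finite (glue c (m * k) (A, B))"
    using A B by (simp add: noncrossing_def glue_def)
  ultimately show ?thesis
    unfolding noncrossing_def by blast
qed

lemma shift_mem_glue_iff:
  assumes "m_diagonal m (k - 1) d" "\<forall>b\<in>B. m_diagonal m (n - k) b"
  shows "shift c d \<in> glue c (m * k) (A, B) \<longleftrightarrow> d \<in> A"
proof -
  have "shift c d \<noteq> spread c (m * k) b" if "b \<in> B" for b
    using assms that m_diagonal_shift_iff[of d] m_diagonal_spread(2) by metis
  then show ?thesis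
    using assms m_diagonal_shift_iff[of d] by (auto simp: glue_def inj_image_mem_iff[OF inj_shift])
qed

text \<open>Besides recovering \<open>B\<close> from the glued set, this later tracks which negative
  simple roots survive a cut.\<close>

lemma spread_mem_glue_iff:
  assumes "m_diagonal m (n - k) d" "\<forall>a\<in>A. m_diagonal m (k - 1) a"
  shows "spread c (m * k) d \<in> glue c (m * k) (A, B) \<longleftrightarrow> d \<in> B"
proof -
  have "spread c (m * k) d \<noteq> shift c a" if "a \<in> A" for a
    using assms that m_diagonal_shift_iff[of a] m_diagonal_spread(2) by metis
  moreover have "spread c (m * k) d \<noteq> e"
    using m_diagonal_spread(2)[OF assms(1)] by (auto simp: under_def)
  ultimately show ?thesis
    by (auto simp: glue_def inj_image_mem_iff[OF inj_spread])
qed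

lemma card_glue:
  assumes A: "noncrossing m (k - 1) A" and B: "noncrossing m (n - k) B"
  shows "card (glue c (m * k) (A, B)) = card A + card B + 1"
proof -
  have "shift c ` A \<inter> spread c (m * k) ` B = {}"
    using A B m_diagonal_shift_iff m_diagonal_spread(2)
    by (fastforce simp: noncrossing_def)
  moreover have "e \<notin> shift c ` A"
    using A m_diagonal_shift_iff by (force simp: noncrossing_def)
  moreover have "e \<notin> spread c (m * k) ` B"
  proof
    assume "e \<in> spread c (m * k) ` B"
    then obtain b where "b \<in> B" "e = spread c (m * k) b" by blast
    then have "\<not> under e e" using B m_diagonal_spread(2)[of b] by (simp add: noncrossing_def)
    then show False by (simp add: under_def)
  qed
  moreover have "finite A" "finite B" using A B by (auto simp: noncrossing_def)
  ultimately show ?thesis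
    by (simp add: glue_def card_Un_disjoint card_image inj_on_subset[OF inj_shift]
        inj_on_subset[OF inj_spread])
qed

lemma inj_on_glue:
  "inj_on (glue c (m * k)) ({A. noncrossing m (k - 1) A} \<times> {B. noncrossing m (n - k) B})"
proof (rule inj_onI, clarify)
  fix A B A' B'
  assume nc: "noncrossing m (k - 1) A" "noncrossing m (n - k) B"
    "noncrossing m (k - 1) A'" "noncrossing m (n - k) B'"
    and eq: "glue c (m * k) (A, B) = glue c (m * k) (A', B')"
  \<comment> \<open>Injectivity holds because each piece can be read off as a preimage of the glued
    set.\<close>
  have A: "A = {d. m_diagonal m (k - 1) d \<and> shift c d \<in> glue c (m * k) (A, B)}"
    if "noncrossing m (k - 1) A" "noncrossing m (n - k) B" for A B
    using that by (auto simp: shift_mem_glue_iff noncrossing_def simp del: shift_simp)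
  have B: "B = {d. m_diagonal m (n - k) d \<and> spread c (m * k) d \<in> glue c (m * k) (A, B)}"
    if "noncrossing m (k - 1) A" "noncrossing m (n - k) B" for A B
    using that by (auto simp: spread_mem_glue_iff noncrossing_def)
  have "A = A'" using A[OF nc(1,2)] A[OF nc(3,4)] unfolding eq by simp
  moreover have "B = B'" using B[OF nc(1,2)] B[OF nc(3,4)] unfolding eq by simp
  ultimately show "A = A' \<and> B = B'" by blast
qed

lemma ex_glue:
  assumes D: "noncrossing m n D" and e: "e \<in> D"
  shows "\<exists>A B. noncrossing m (k - 1) A \<and> noncrossing m (n - k) B \<and> D = glue c (m * k) (A, B)"
proof -
  \<comment> \<open>The pieces are preimages of \<open>D\<close>. Excluding \<open>e\<close> keeps
    the side \<open>(0, m * k + 1)\<close> out of \<open>A\<close> and the side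
    \<open>(c, c + 1)\<close> out of \<open>B\<close>.\<close>
  define A where "A = {d. shift c d \<in> D \<and> under e (shift c d) \<and> shift c d \<noteq> e}"
  define B where "B = {d. spread c (m * k) d \<in> D \<and> spread c (m * k) d \<noteq> e}"
  have "finite (shift c ` A)" "finite (spread c (m * k) ` B)"
    using D by (auto simp: A_def B_def noncrossing_def intro: finite_subset[of _ D])
  then have fin: "finite A" "finite B"
    using inj_on_subset[OF inj_shift] inj_on_subset[OF inj_spread] by (auto dest: finite_imageD)
  have A: "noncrossing m (k - 1) A"
    unfolding noncrossing_def
  proof (intro conjI ballI)
    fix d assume "d \<in> A"
    then show "m_diagonal m (k - 1) d"
      using D m_diagonal_shift_iff by (auto simp: A_def noncrossing_def)
  next
    fix d d' assume "d \<in> A" "d' \<in> A"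
    then have "\<not> crosses (shift c d) (shift c d')"
      using D by (auto simp: A_def noncrossing_def)
    then show "\<not> crosses d d'" by (simp add: crosses_shift)
  qed (fact fin)
  have B: "noncrossing m (n - k) B"
    unfolding noncrossing_def
  proof (intro conjI ballI)
    fix d assume "d \<in> B"
    then show "m_diagonal m (n - k) d"
      using D m_diagonal_if_spread by (auto simp: B_def noncrossing_def)
  next
    fix d d' assume "d \<in> B" "d' \<in> B"
    then have "\<not> crosses (spread c (m * k) d) (spread c (m * k) d')"
      using D by (auto simp: B_def noncrossing_def)
    then show "\<not> crosses d d'" by (simp add: crosses_spread)
  qed (fact fin)
  have "D \<subseteq> glue c (m * k) (A, B)"
  proof
    fix d assume d: "d \<in> D"
    obtain x y where xy: "d = (x, y)" by force
    have "x < y" using d D m by (auto simp: noncrossing_def xy m_diagonal_iff)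
    show "d \<in> glue c (m * k) (A, B)"
    proof (cases "d = e \<or> under e d")
      case True
      have "d = shift c (x - c, y - c)" if "under e d"
        using that \<open>x < y\<close> by (auto simp: under_def xy)
      then show ?thesis using True d unfolding glue_def A_def by blast
    next
      case False
      moreover have "\<not> crosses d e" using d D e by (auto simp: noncrossing_def)
      ultimately obtain b where "d = spread c (m * k) b"
        using ex_spread_if_not_crosses \<open>x < y\<close> xy by metis
      then show ?thesis using False d unfolding glue_def B_def by blast
    qed
  qed
  moreover have "glue c (m * k) (A, B) \<subseteq> D"
    using e by (auto simp: glue_def A_def B_def)
  ultimately show ?thesis using A B by blast
qed

end

text \<open>Cutting along any member gives pieces of sizes at most \<open>k - 1\<close> and
  \<open>n - k\<close> by induction, and the cut itself adds one.\<close>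

lemma card_noncrossing_le:
  assumes "0 < m" "noncrossing m n D"
  shows "card D \<le> n"
  using assms(2)
proof (induction n arbitrary: D rule: less_induct)
  case (less n)
  show ?case
  proof (cases "D = {}")
    case False
    then obtain e where e: "e \<in> D" by blast
    then have "m_diagonal m n e" using less.prems by (auto simp: noncrossing_def)
    then obtain k c where k: "1 \<le> k" "k \<le> n" "c + m * k \<le> m * (n + 1)" "e = (c, c + m * k + 1)"
      using assms(1) by (auto simp: m_diagonal_iff)
    then interpret cut m n k c using assms(1) by unfold_locales
    obtain A B where AB: "noncrossing m (k - 1) A" "noncrossing m (n - k) B"
      "D = glue c (m * k) (A, B)"
      using ex_glue less.prems e \<open>e = _\<close> by blast
    moreover have "card A \<le> k - 1" "card B \<le> n - k"
      using less.IH AB k by auto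
    ultimately show ?thesis using card_glue k by simp
  qed simp
qed

lemma mem_m_dissections: "D \<in> m_dissections m n \<longleftrightarrow> noncrossing m n D \<and> card D = n"
  by (auto simp: m_dissections_def noncrossing_def)

lemma (in cut) bij_betw_glue:
  "bij_betw (glue c (m * k)) (m_dissections m (k - 1) \<times> m_dissections m (n - k))
     {D \<in> m_dissections m n. e \<in> D}"
proof (rule bij_betw_imageI)
  show "inj_on (glue c (m * k)) (m_dissections m (k - 1) \<times> m_dissections m (n - k))"
    by (rule inj_on_subset[OF inj_on_glue]) (auto simp: mem_m_dissections)
  have "e \<in> glue c (m * k) (A, B)" for A B by (simp add: glue_def)
  moreover have "D \<in> glue c (m * k) ` (m_dissections m (k - 1) \<times> m_dissections m (n - k))"
    if D: "noncrossing m n D" "card D = n" "e \<in> D" for D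
  proof -
    obtain A B where AB: "noncrossing m (k - 1) A" "noncrossing m (n - k) B"
      "D = glue c (m * k) (A, B)"
      using ex_glue D by blast
    \<comment> \<open>The total is the largest possible, so both pieces attain their bounds and are
      themselves dissections.\<close>
    then have "card A + card B + 1 = n" using card_glue D by simp
    moreover have "card A \<le> k - 1" "card B \<le> n - k"
      using card_noncrossing_le[OF m] AB by auto
    ultimately show ?thesis using AB k by (auto simp: mem_m_dissections)
  qed
  ultimately show "glue c (m * k) ` (m_dissections m (k - 1) \<times> m_dissections m (n - k)) =
      {D \<in> m_dissections m n. e \<in> D}"
    using k by (auto simp: mem_m_dissections glue_mem_noncrossing card_glue)
qed


lemma (in cut) card_dissections_containing:
  "card {D \<in> m_dissections m n. e \<in> D} =
     card (m_dissections m (k - 1)) * card (m_dissections m (n - k))"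
  using bij_betw_same_card[OF bij_betw_glue] by (simp add: card_cartesian_product)

section \<open>Counting dissections\<close>

lemma finite_m_dissections: "finite (m_dissections m n)"
proof (rule finite_subset)
  show "m_dissections m n \<subseteq> Pow ({..<num_vertices m n} \<times> {..<num_vertices m n})"
    by (fastforce simp: m_dissections_def m_diagonal_def Let_def)
qed simp

text \<open>Double counting of the pairs of a dissection and one of its diagonals: there are
  \<open>m (n + 1 - k) + 1\<close> diagonals that cut off a polygon with \<open>m k + 2\<close> vertices.\<close>

lemma m_dissections_recurrence:
  assumes m: "0 < m"
  shows "n * card (m_dissections m n) =
    (\<Sum>j<n. (m * (n - j) + 1) * (card (m_dissections m j) * card (m_dissections m (n - 1 - j))))"
proof -
  define F where "F j = card (m_dissections m j)" for j
  define I where "I = (SIGMA k:{1..n}. {..m * (n + 1 - k)})"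
  define h where "h = (\<lambda>(k, a). (a, a + m * k + 1))"
  have I: "a + m * k \<le> m * (n + 1) \<longleftrightarrow> a \<le> m * (n + 1 - k)" if "k \<le> n" for a k
  proof -
    obtain l where "n = k + l" using \<open>k \<le> n\<close> le_Suc_ex by blast
    then show ?thesis by (auto simp: algebra_simps)
  qed
  have E: "{d. m_diagonal m n d} = h ` I"
  proof (intro equalityI subsetI)
    fix d assume "d \<in> {d. m_diagonal m n d}"
    then obtain k a where "1 \<le> k" "k \<le> n" "a + m * k \<le> m * (n + 1)" "d = h (k, a)"
      using m by (auto simp: m_diagonal_iff h_def)
    then show "d \<in> h ` I" using I by (auto simp: I_def)
  next
    fix d assume "d \<in> h ` I"
    then obtain k a where "1 \<le> k" "k \<le> n" "a \<le> m * (n + 1 - k)" "d = h (k, a)"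
      by (auto simp: I_def)
    then show "d \<in> {d. m_diagonal m n d}" using I m by (auto simp: m_diagonal_iff h_def)
  qed
  have inj: "inj_on h I" using m by (auto simp: inj_on_def h_def)
  have "n * F n = (\<Sum>D\<in>m_dissections m n. card {d \<in> h ` I. d \<in> D})"
  proof -
    have "card {d \<in> h ` I. d \<in> D} = n" if "D \<in> m_dissections m n" for D
    proof -
      have "{d \<in> h ` I. d \<in> D} = D" using that unfolding E[symmetric] m_dissections_def by blast
      then show ?thesis using that by (simp add: m_dissections_def)
    qed
    then show ?thesis by (simp add: F_def)
  qed
  also have "\<dots> = (\<Sum>d\<in>h ` I. card {D \<in> m_dissections m n. d \<in> D})"
    by (rule sum_multicount_gen) (auto simp: I_def finite_m_dissections)
  also have "\<dots> = (\<Sum>(k, a)\<in>I. F (k - 1) * F (n - k))"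
    unfolding sum.reindex[OF inj]
  proof (rule sum.cong)
    fix x assume "x \<in> I"
    then obtain k a where x: "x = (k, a)" "1 \<le> k" "k \<le> n" "a + m * k \<le> m * (n + 1)"
      using I by (auto simp: I_def)
    then interpret cut m n k a using m by unfold_locales
    show "((\<lambda>d. card {D \<in> m_dissections m n. d \<in> D}) \<circ> h) x = (case x of (k, a) \<Rightarrow> F (k - 1) * F (n - k))"
      using card_dissections_containing by (simp add: x h_def F_def)
  qed simp
  also have "\<dots> = (\<Sum>k\<in>{1..n}. (m * (n + 1 - k) + 1) * (F (k - 1) * F (n - k)))"
    unfolding I_def by (subst sum.Sigma[symmetric]) auto
  \<comment> \<open>Here \<open>j = k - 1\<close> is the parameter of the polygon under the
    diagonal.\<close>
  also have "\<dots> = (\<Sum>j<n. (m * (n - j) + 1) * (F j * F (n - 1 - j)))"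
    by (rule sum.reindex_bij_witness[of _ Suc "\<lambda>k. k - 1"]) auto
  finally show ?thesis by (simp only: F_def)
qed

lemma card_m_dissections:
  assumes m: "0 < m"
  shows "card (m_dissections m n) = raney m n (m + 1)"
proof (induction n rule: less_induct)
  case (less n)
  define T where "T j = raney m j (m + 1) * raney m (n - 1 - j) (m + 1)" for j
  show ?case
  proof (cases "n = 0")
    case True
    have "m_dissections m 0 = {{}}" by (auto simp: m_dissections_def)
    then show ?thesis using True by simp
  next
    case False
    have "n * card (m_dissections m n) = (\<Sum>j<n. (m * (n - j) + 1) * T j)"
      unfolding m_dissections_recurrence[OF m] T_def by (intro sum.cong) (auto simp: less)
    \<comment> \<open>\<open>T\<close> is symmetric under \<open>j -> n - 1 - j\<close>. Adding the
      reversed sum makes the weights constant, equal to \<open>m * (n + 1) + 2\<close>, which is the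
      recurrence of the Raney numbers.\<close>
    moreover have "(\<Sum>j<n. (m * (n - j) + 1) * T j) = (\<Sum>j<n. (m * (j + 1) + 1) * T j)"
      by (subst sum.nat_diff_reindex[symmetric]) (intro sum.cong, auto simp: T_def Suc_diff_Suc)
    ultimately have "2 * n * card (m_dissections m n) =
        (\<Sum>j<n. (m * (n - j) + 1) * T j) + (\<Sum>j<n. (m * (j + 1) + 1) * T j)"
      by simp
    also have "\<dots> = (\<Sum>j<n. (m * (n + 1) + 2) * T j)"
      unfolding sum.distrib[symmetric]
    proof (rule sum.cong)
      fix j assume "j \<in> {..<n}"
      then obtain l where "n = j + l" by (metis lessThan_iff less_imp_le le_Suc_ex)
      then show "(m * (n - j) + 1) * T j + (m * (j + 1) + 1) * T j = (m * (n + 1) + 2) * T j"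
        by (simp add: algebra_simps)
    qed simp
    also have "\<dots> = 2 * n * raney m n (m + 1)"
      using raney_recurrence[of n m] False by (simp add: T_def sum_distrib_left)
    finally show ?thesis using False by simp
  qed
qed

section \<open>Prescribed negative simple roots and maximal parts\<close>

definition neg_roots :: "nat \<Rightarrow> nat \<Rightarrow> (nat \<times> nat) set \<Rightarrow> nat set" where
  "neg_roots m n D = {i \<in> {1..n}. neg_simple_root m n i \<in> D}"

definition max_parts :: "nat \<Rightarrow> nat \<Rightarrow> nat list \<Rightarrow> nat set" where
  "max_parts m n lam = {i \<in> {1..n}. lam ! (i - 1) = (n - i + 1) * m}"

lemma bij_betw_Collect_conj:
  assumes "bij_betw f A B"
  shows "bij_betw f {a \<in> A. P (f a)} {b \<in> B. P b}"
  using assms by (auto simp: bij_betw_def inj_on_def)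

text \<open>Puts both parities into the normal form of \<open>m_diagonal_iff\<close>, with
  \<open>k = n + 1 - i\<close> and left end \<open>i div 2 * m\<close>.\<close>

lemma neg_simple_root_eq:
  assumes "i \<le> n"
  shows "neg_simple_root m n i = (i div 2 * m, i div 2 * m + m * (n + 1 - i) + 1)"
proof (cases "odd i")
  case True
  then obtain p where p: "i = 2 * p + 1" by (elim oddE)
  obtain l where "n = i + l" using assms le_Suc_ex by blast
  then show ?thesis using p by (simp add: neg_simple_root_def algebra_simps)
next
  case False
  then obtain p where p: "i = 2 * p" by auto
  obtain l where "n = i + l" using assms le_Suc_ex by blast
  then show ?thesis using p by (simp add: neg_simple_root_def algebra_simps)
qed

lemma m_diagonal_neg_simple_root:
  assumes "0 < m" "1 \<le> i" "i \<le> n"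
  shows "i div 2 * m + m * (n + 1 - i) \<le> m * (n + 1)"
    and "m_diagonal m n (neg_simple_root m n i)"
proof -
  have "m * (i div 2 + (n + 1 - i)) \<le> m * (n + 1)"
    using assms by (intro mult_le_mono2) linarith
  then show *: "i div 2 * m + m * (n + 1 - i) \<le> m * (n + 1)"
    by (simp only: distrib_left mult.commute)
  then show "m_diagonal m n (neg_simple_root m n i)"
    using assms by (auto simp: m_diagonal_iff neg_simple_root_eq)
qed

text \<open>For \<open>j < i\<close> the left end of the root is at most that of
  \<open>-\<alpha>_i\<close> and stays, while the right end lies beyond it and moves by exactly the
  difference between the two polygon sizes.\<close>

lemma spread_neg_simple_root:
  assumes "0 < m" "1 \<le> j" "j < i" "i \<le> n"
  shows "spread (i div 2 * m) (m * (n + 1 - i)) (neg_simple_root m (i - 1) j) = neg_simple_root m n j"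
proof -
  have root: "neg_simple_root m (i - 1) j = (j div 2 * m, j div 2 * m + m * (i - j) + 1)"
    using assms neg_simple_root_eq[of j "i - 1" m] by simp
  have left: "j div 2 * m \<le> i div 2 * m"
    using assms by (intro mult_le_mono1) linarith
  have "i div 2 * m \<le> (j div 2 + (i - j)) * m"
    using assms by (intro mult_le_mono1) linarith
  then have right: "\<not> j div 2 * m + m * (i - j) + 1 \<le> i div 2 * m"
    unfolding add_mult_distrib mult.commute[of m] by linarith
  have "m * (i - j) + m * (n + 1 - i) = m * (n + 1 - j)"
    using assms by (simp flip: distrib_left)
  then have sum: "j div 2 * m + m * (i - j) + 1 + m * (n + 1 - i) = j div 2 * m + m * (n + 1 - j) + 1"
    by linarith
  have "j \<le> n" using assms by simp
  show ?thesis
    unfolding root neg_simple_root_eq[OF \<open>j \<le> n\<close>] spread_simp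
    by (simp only: left right sum if_True if_False)
qed

text \<open>As \<open>i\<close> exceeds every element of \<open>S\<close>, all other prescribed
  roots come from the contracted polygon of parameter \<open>i - 1\<close>; the piece under
  \<open>-\<alpha>_i\<close>, of parameter \<open>n - i\<close>, is unconstrained.\<close>

lemma card_neg_roots_insert:
  assumes m: "0 < m" and i: "1 \<le> i" "i \<le> n" and S: "S \<subseteq> {1..i - 1}"
  shows "card {D \<in> m_dissections m n. insert i S \<subseteq> neg_roots m n D} =
    card (m_dissections m (n - i)) * card {D \<in> m_dissections m (i - 1). S \<subseteq> neg_roots m (i - 1) D}"
proof -
  define k where "k = n + 1 - i"
  define c where "c = i div 2 * m"
  have sizes: "k - 1 = n - i" "n - k = i - 1" using i by (auto simp: k_def)
  interpret cut m n k c
    using m i m_diagonal_neg_simple_root(1)[OF m i] by unfold_locales (auto simp: k_def c_def)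
  have e: "neg_simple_root m n i = e"
    using i by (simp add: neg_simple_root_eq k_def c_def)
  have iff: "S \<subseteq> neg_roots m n (glue c (m * k) (A, B)) \<longleftrightarrow> S \<subseteq> neg_roots m (i - 1) B"
    if "A \<in> m_dissections m (n - i)" "B \<in> m_dissections m (i - 1)" for A B
  proof -
    have "neg_simple_root m n j \<in> glue c (m * k) (A, B) \<longleftrightarrow> neg_simple_root m (i - 1) j \<in> B"
      if j: "j \<in> S" for j
    proof -
      have "j \<in> {1..i - 1}" using j S by blast
      then have j: "1 \<le> j" "j \<le> i - 1" "j < i" by auto
      have "spread c (m * k) (neg_simple_root m (i - 1) j) = neg_simple_root m n j"
        unfolding c_def k_def using m j i by (intro spread_neg_simple_root)
      moreover have "m_diagonal m (n - k) (neg_simple_root m (i - 1) j)"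
        unfolding sizes using m j by (intro m_diagonal_neg_simple_root(2))
      moreover have "\<forall>a\<in>A. m_diagonal m (k - 1) a"
        using \<open>A \<in> _\<close> unfolding sizes by (simp add: m_dissections_def)
      ultimately show ?thesis using spread_mem_glue_iff by metis
    qed
    moreover have "j \<in> {1..n}" "j \<in> {1..i - 1}" if "j \<in> S" for j
      using subsetD[OF S that] i by auto
    ultimately show ?thesis by (auto simp: neg_roots_def)
  qed
  have "bij_betw (glue c (m * k))
      {x \<in> m_dissections m (n - i) \<times> m_dissections m (i - 1). S \<subseteq> neg_roots m n (glue c (m * k) x)}
      {D \<in> {D \<in> m_dissections m n. e \<in> D}. S \<subseteq> neg_roots m n D}"
    using bij_betw_glue unfolding sizes by (rule bij_betw_Collect_conj)
  moreover have "{x \<in> m_dissections m (n - i) \<times> m_dissections m (i - 1).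
        S \<subseteq> neg_roots m n (glue c (m * k) x)} =
      m_dissections m (n - i) \<times> {B \<in> m_dissections m (i - 1). S \<subseteq> neg_roots m (i - 1) B}"
    using iff by blast
  moreover have "{D \<in> {D \<in> m_dissections m n. e \<in> D}. S \<subseteq> neg_roots m n D} =
      {D \<in> m_dissections m n. insert i S \<subseteq> neg_roots m n D}"
    using i by (auto simp: neg_roots_def e)
  ultimately show ?thesis
    using bij_betw_same_card by (fastforce simp: card_cartesian_product)
qed

section \<open>Cutting a partition at a maximal part\<close>

definition stack :: "nat \<Rightarrow> nat list \<times> nat list \<Rightarrow> nat list" where
  "stack w = (\<lambda>(\<nu>, \<mu>). map (\<lambda>x. x + w) \<mu> @ w # \<nu>)"

text \<open>Raising the first \<open>p\<close> parts by \<open>m * (q + 1)\<close> is exactly what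
  turns their bounds for \<open>p\<close> into those for \<open>p + q + 1\<close>; the last
  \<open>q\<close> bounds already coincide.\<close>

lemma stack_mem_m_partitions:
  assumes "length \<mu> = p" "length \<nu> = q"
  shows "stack (m * (q + 1)) (\<nu>, \<mu>) \<in> m_partitions m (p + q + 1) \<longleftrightarrow>
    \<nu> \<in> m_partitions m q \<and> \<mu> \<in> m_partitions m p"
proof -
  define lam where "lam = stack (m * (q + 1)) (\<nu>, \<mu>)"
  have split: "(\<forall>j<p + q + 1. Q j) \<longleftrightarrow> (\<forall>j<p. Q j) \<and> Q p \<and> (\<forall>j<q. Q (p + 1 + j))" for Q
  proof -
    have *: "Q j" if Q: "\<forall>j<p. Q j" "Q p" "\<forall>j<q. Q (p + 1 + j)" "j < p + q + 1" for j
    proof -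
      consider "j < p" | "j = p" | "p + 1 + (j - p - 1) = j" "j - p - 1 < q"
        using Q(4) by linarith
      then show ?thesis
      proof cases
        case 3
        then show ?thesis using Q(3) by metis
      qed (use Q in auto)
    qed
    show ?thesis
    proof
      assume "\<forall>j<p + q + 1. Q j"
      then show "(\<forall>j<p. Q j) \<and> Q p \<and> (\<forall>j<q. Q (p + 1 + j))" by simp
    qed (use * in blast)
  qed
  have "lam ! j \<le> m * (p + q + 1 - j) \<longleftrightarrow> \<mu> ! j \<le> m * (p - j)" if "j < p" for j
  proof -
    have "p + q + 1 - j = (p - j) + (q + 1)" using \<open>j < p\<close> by simp
    then have "m * (p + q + 1 - j) = m * (p - j) + m * (q + 1)" by (simp only: distrib_left)
    then show ?thesis using that assms by (simp add: lam_def stack_def nth_append)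
  qed
  moreover have "lam ! p = m * (q + 1)" "lam ! (p + 1 + j) = \<nu> ! j" for j
    using assms by (simp_all add: lam_def stack_def nth_append)
  ultimately have bound: "(\<forall>j<p + q + 1. lam ! j \<le> m * (p + q + 1 - j)) \<longleftrightarrow>
      (\<forall>j<p. \<mu> ! j \<le> m * (p - j)) \<and> (\<forall>j<q. \<nu> ! j \<le> m * (q - j))"
    unfolding split by (simp add: algebra_simps)
  \<comment> \<open>Monotonicity across the junction follows from the bounds on
    \<open>\<nu>\<close>.\<close>
  have small: "y \<le> m * (q + 1)" if \<nu>: "\<forall>j<q. \<nu> ! j \<le> m * (q - j)" and y: "y \<in> set \<nu>" for y
  proof -
    obtain j where "j < q" "y = \<nu> ! j" using y assms by (metis in_set_conv_nth)
    moreover have "m * (q - j) \<le> m * (q + 1)" by (intro mult_le_mono2) simp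
    ultimately show ?thesis using \<nu> by (meson le_trans)
  qed
  have "sorted_wrt (\<ge>) lam \<longleftrightarrow>
      sorted_wrt (\<ge>) \<mu> \<and> sorted_wrt (\<ge>) \<nu> \<and> (\<forall>y\<in>set \<nu>. y \<le> m * (q + 1))"
    by (auto simp: lam_def stack_def sorted_wrt_append sorted_wrt_map intro: trans_le_add2)
  moreover have "length lam = p + q + 1" using assms by (simp add: lam_def stack_def)
  ultimately show ?thesis
    using bound small assms unfolding m_partitions_def lam_def[symmetric] by blast
qed

lemma bij_betw_stack:
  "bij_betw (stack (m * (q + 1))) (m_partitions m q \<times> m_partitions m p)
     {lam \<in> m_partitions m (p + q + 1). lam ! p = m * (q + 1)}"
proof (rule bij_betw_imageI)
  define w where "w = m * (q + 1)"
  have len: "length lam = r" if "lam \<in> m_partitions m r" for lam r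
    using that by (simp add: m_partitions_def)
  have inj: "inj (map (\<lambda>x. x + w))" by (simp add: inj_def)
  show "inj_on (stack w) (m_partitions m q \<times> m_partitions m p)"
    using len injD[OF inj] by (fastforce simp: inj_on_def stack_def)
  have "lam \<in> stack w ` (m_partitions m q \<times> m_partitions m p)"
    if lam: "lam \<in> m_partitions m (p + q + 1)" "lam ! p = w" for lam
  proof -
    \<comment> \<open>The truncated subtraction is exact, since parts before position
      \<open>p\<close> are at least \<open>w\<close> by sortedness.\<close>
    define \<mu> where "\<mu> = map (\<lambda>x. x - w) (take p lam)"
    define \<nu> where "\<nu> = drop (p + 1) lam"
    have l: "length lam = p + q + 1" using len lam by blast
    then have lens: "length \<mu> = p" "length \<nu> = q" by (auto simp: \<mu>_def \<nu>_def)
    have eq: "lam = take p lam @ w # \<nu>"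
      using l lam(2) id_take_nth_drop[of p lam] by (simp add: \<nu>_def)
    then have "sorted_wrt (\<ge>) (take p lam @ w # \<nu>)" using lam by (simp add: m_partitions_def)
    then have "w \<le> x" if "x \<in> set (take p lam)" for x
      using that by (simp add: sorted_wrt_append)
    then have "map (\<lambda>x. x + w) \<mu> = take p lam"
      unfolding \<mu>_def map_map by (intro map_idI) auto
    then have "lam = stack w (\<nu>, \<mu>)" using eq by (simp add: stack_def)
    then show ?thesis
      using lam stack_mem_m_partitions[OF lens] by (auto simp: w_def)
  qed
  moreover have "stack w (\<nu>, \<mu>) \<in> {lam \<in> m_partitions m (p + q + 1). lam ! p = w}"
    if "\<nu> \<in> m_partitions m q" "\<mu> \<in> m_partitions m p" for \<nu> \<mu>
  proof -
    have "stack w (\<nu>, \<mu>) ! p = w" using len that by (auto simp: stack_def nth_append)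
    then show ?thesis using that stack_mem_m_partitions[OF len len] by (simp add: w_def)
  qed
  ultimately show "stack w ` (m_partitions m q \<times> m_partitions m p) =
      {lam \<in> m_partitions m (p + q + 1). lam ! p = w}"
    by blast
qed

text \<open>The counterpart of \<open>card_neg_roots_insert\<close> with the same factors: raising
  by \<open>w\<close> sends the maximal value of an earlier part to its maximal value in the larger
  partition.\<close>

lemma card_max_parts_insert:
  assumes i: "1 \<le> i" "i \<le> n" and S: "S \<subseteq> {1..i - 1}"
  shows "card {lam \<in> m_partitions m n. insert i S \<subseteq> max_parts m n lam} =
    card (m_partitions m (n - i)) * card {lam \<in> m_partitions m (i - 1). S \<subseteq> max_parts m (i - 1) lam}"
proof -
  define p where "p = i - 1"
  define q where "q = n - i"
  define w where "w = m * (q + 1)"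
  have n: "n = p + q + 1" using i by (auto simp: p_def q_def)
  have iff: "S \<subseteq> max_parts m n (stack w (\<nu>, \<mu>)) \<longleftrightarrow> S \<subseteq> max_parts m p \<mu>"
    if "\<mu> \<in> m_partitions m p" for \<mu> \<nu>
  proof -
    have "stack w (\<nu>, \<mu>) ! (j - 1) = (n - j + 1) * m \<longleftrightarrow> \<mu> ! (j - 1) = (p - j + 1) * m"
      if j: "j \<in> S" for j
    proof -
      have j: "1 \<le> j" "j \<le> p" using j S by (auto simp: p_def)
      then have "n - j + 1 = (p - j + 1) + (q + 1)" by (simp add: n)
      then have "(n - j + 1) * m = (p - j + 1) * m + w" by (simp only: w_def add_mult_distrib mult.commute[of m])
      moreover have "j - 1 < length \<mu>" using j \<open>\<mu> \<in> _\<close> by (simp add: m_partitions_def)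
      ultimately show ?thesis by (simp add: stack_def nth_append)
    qed
    moreover have "j \<in> {1..n}" "j \<in> {1..p}" if "j \<in> S" for j
      using subsetD[OF S that] i by (auto simp: p_def)
    ultimately show ?thesis by (auto simp: max_parts_def)
  qed
  have "bij_betw (stack w)
      {x \<in> m_partitions m q \<times> m_partitions m p. S \<subseteq> max_parts m n (stack w x)}
      {lam \<in> {lam \<in> m_partitions m n. lam ! p = w}. S \<subseteq> max_parts m n lam}"
    using bij_betw_stack unfolding n w_def by (rule bij_betw_Collect_conj)
  moreover have "{x \<in> m_partitions m q \<times> m_partitions m p. S \<subseteq> max_parts m n (stack w x)} =
      m_partitions m q \<times> {\<mu> \<in> m_partitions m p. S \<subseteq> max_parts m p \<mu>}"
    using iff by blast
  moreover have "{lam \<in> {lam \<in> m_partitions m n. lam ! p = w}. S \<subseteq> max_parts m n lam} =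
      {lam \<in> m_partitions m n. insert i S \<subseteq> max_parts m n lam}"
  proof -
    have "i \<in> max_parts m n lam \<longleftrightarrow> lam ! p = w" for lam
      using i by (simp add: max_parts_def p_def w_def q_def mult.commute)
    then show ?thesis by auto
  qed
  ultimately show ?thesis
    using bij_betw_same_card by (fastforce simp: card_cartesian_product p_def q_def)
qed

lemma card_neg_roots_eq_card_max_parts:
  assumes m: "0 < m" and "S \<subseteq> {1..n}"
  shows "card {D \<in> m_dissections m n. S \<subseteq> neg_roots m n D} =
    card {lam \<in> m_partitions m n. S \<subseteq> max_parts m n lam}"
  using assms(2)
proof (induction n arbitrary: S rule: less_induct)
  case (less n)
  show ?case
  proof (cases "S = {}")
    case True
    then show ?thesis by (simp add: card_m_dissections[OF m] card_m_partitions)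
  next
    case False
    have fin: "finite S" using less.prems finite_subset by blast
    \<comment> \<open>Both insertion lemmas need the remaining indices below \<open>i\<close>. They
      leave a total count and a count with the smaller parameter \<open>i - 1\<close>.\<close>
    define i where "i = Max S"
    define S' where "S' = S - {i}"
    have S: "S = insert i S'" using Max_in[OF fin False] by (auto simp: S'_def i_def)
    have i: "1 \<le> i" "i \<le> n" using less.prems S by auto
    have S': "S' \<subseteq> {1..i - 1}"
    proof
      fix j assume j: "j \<in> S'"
      then have "j \<le> i" "j \<noteq> i" "1 \<le> j"
        using Max_ge[OF fin] less.prems by (auto simp: S'_def i_def)
      then show "j \<in> {1..i - 1}" by auto
    qed
    have "i - 1 < n" using i by simp
    then show ?thesis
      unfolding S card_neg_roots_insert[OF m i S'] card_max_parts_insert[OF i S']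
      using less.IH[OF _ S'] by (simp add: card_m_dissections[OF m] card_m_partitions)
  qed
qed

theorem theorem1p4:
  fixes n m :: nat
  assumes "0 < n" and "0 < m"
  shows "\<exists>\<psi>. bij_betw \<psi> (m_dissections m n) (m_partitions m n) \<and>
           (\<forall>i\<in>{1..n}. \<forall>D\<in>m_dissections m n.
              neg_simple_root m n i \<in> D \<longleftrightarrow> \<psi> D ! (i - 1) = (n - i + 1) * m)"
proof -
  have "\<exists>\<psi>. bij_betw \<psi> (m_dissections m n) (m_partitions m n) \<and>
      (\<forall>D\<in>m_dissections m n. max_parts m n (\<psi> D) = neg_roots m n D)"
  proof (rule ex_bij_betw_if_card_superset_eq[of _ _ "{1..n}"])
    show "card {D \<in> m_dissections m n. S \<subseteq> neg_roots m n D} =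
        card {lam \<in> m_partitions m n. S \<subseteq> max_parts m n lam}" if "S \<subseteq> {1..n}" for S
      using \<open>0 < m\<close> that by (rule card_neg_roots_eq_card_max_parts)
  qed (auto simp: finite_m_dissections finite_m_partitions neg_roots_def max_parts_def)
  then obtain \<psi> where \<psi>: "bij_betw \<psi> (m_dissections m n) (m_partitions m n)"
    "\<And>D. D \<in> m_dissections m n \<Longrightarrow> max_parts m n (\<psi> D) = neg_roots m n D"
    by blast
  have "neg_simple_root m n i \<in> D \<longleftrightarrow> \<psi> D ! (i - 1) = (n - i + 1) * m"
    if "i \<in> {1..n}" "D \<in> m_dissections m n" for i D
  proof -
    have "i \<in> max_parts m n (\<psi> D) \<longleftrightarrow> i \<in> neg_roots m n D" using \<psi>(2) that by simp
    then show ?thesis using that by (simp add: max_parts_def neg_roots_def)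
  qed
  then show ?thesis using \<psi>(1) by blast
qed

end
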